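(* Let $\mathcal{C},\mathcal{D},\mathcal{C}',\mathcal{D}'$ be small connected categories and let $F,G\colon\mathcal{C}\to\mathcal{D}$ be functors. (1) If $\alpha\colon\mathcal{D}\to\mathcal{D}'$ is a functor with a left homotopy inverse (i.e. there is a functor $\beta\colon\mathcal{D}'\to\mathcal{D}$ with $\beta\circ\alpha\simeq 1_{\mathcal{D}}$), then $$\mathrm{cD}(\alpha\circ F,\alpha\circ G)=\mathrm{cD}(F,G).$$ (2) If $\beta\colon\mathcal{C}'\to\mathcal{C}$ is a functor with a right homotopy inverse (i.e. there is a functor $\alpha\colon\mathcal{C}\to\mathcal{C}'$ with $\beta\circ\alpha\simeq 1_{\mathcal{C}}$), then $$\mathrm{cD}(F\circ\beta,G\circ\beta)=\mathrm{cD}(F,G).$$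
   Context: Interval category: for $m\ge 0$, $\mathcal{I}_m$ has objects $0,1,\dots,m$ and its only non-identity arrows are: exactly one arrow $r\to s$ whenever $r$ is even and $s=r-1$ or $s=r+1$. Two functors $F,G\colon\mathcal{C}\to\mathcal{D}$ between small categories are homotopic, $F\simeq G$, if for some $m\ge 0$ there is a functor $H\colon\mathcal{C}\times\mathcal{I}_m\to\mathcal{D}$ with $H_0=F$ and $H_m=G$ (equivalently, $F$ and $G$ are joined by a finite zigzag of natural transformations). A small category is connected if any two objects are joined by a finite zigzag of arrows. Members of covers (subcategories) are not required to be connected. Geometric cover: a collection $\{\mathcal{U}_\lambda\}_{\lambda\in\Lambda}$ of subcategories of $\mathcal{C}$ such that for every sequence of composable arrows $f_1,\dots,f_n$ in $\mathcal{C}$ there is $\lambda\in\Lambda$ such that every $f_i$ belongs to $\mathcal{U}_\lambda$. Categorical homotopic distance: for functors $F,G\colon\mathcal{C}\to\mathcal{D}$, $\mathrm{cD}(F,G)$ is the least integer $n\ge 0$ such that there is a geometric cover $\{\mathcal{U}_0,\dots,\mathcal{U}_n\}$ of $\mathcal{C}$ with $F_{|\mathcal{U}_j}\simeq G_{|\mathcal{U}_j}$ for all $j$; it is $\infty$ if there is no such cover. *)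

theory Defs
  imports Main "HOL-Library.Extended_Nat"
begin

text \<open>Small categories are given by a set of objects and a set of arrows inside two types.
  The structure maps are total HOL functions, but only their values on these sets matter;
  \<open>Comp C g f\<close> is the composite of \<open>g\<close> after \<open>f\<close>.\<close>

record ('o, 'a) cat =
  Obj :: "'o set"
  Arr :: "'a set"
  Dom :: "'a \<Rightarrow> 'o"
  Cod :: "'a \<Rightarrow> 'o"
  Idn :: "'o \<Rightarrow> 'a"
  Comp :: "'a \<Rightarrow> 'a \<Rightarrow> 'a"

locale category =
  fixes C :: "('o, 'a) cat"
  assumes Dom_in: "f \<in> Arr C \<Longrightarrow> Dom C f \<in> Obj C"
    and Cod_in: "f \<in> Arr C \<Longrightarrow> Cod C f \<in> Obj C"
    and Idn_in: "x \<in> Obj C \<Longrightarrow> Idn C x \<in> Arr C"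
    and Dom_Idn: "x \<in> Obj C \<Longrightarrow> Dom C (Idn C x) = x"
    and Cod_Idn: "x \<in> Obj C \<Longrightarrow> Cod C (Idn C x) = x"
    and Comp_in: "\<lbrakk>f \<in> Arr C; g \<in> Arr C; Cod C f = Dom C g\<rbrakk> \<Longrightarrow> Comp C g f \<in> Arr C"
    and Dom_Comp: "\<lbrakk>f \<in> Arr C; g \<in> Arr C; Cod C f = Dom C g\<rbrakk> \<Longrightarrow> Dom C (Comp C g f) = Dom C f"
    and Cod_Comp: "\<lbrakk>f \<in> Arr C; g \<in> Arr C; Cod C f = Dom C g\<rbrakk> \<Longrightarrow> Cod C (Comp C g f) = Cod C g"
    and Comp_Idn_right: "f \<in> Arr C \<Longrightarrow> Comp C f (Idn C (Dom C f)) = f"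
    and Comp_Idn_left: "f \<in> Arr C \<Longrightarrow> Comp C (Idn C (Cod C f)) f = f"
    and Comp_assoc: "\<lbrakk>f \<in> Arr C; g \<in> Arr C; h \<in> Arr C; Cod C f = Dom C g; Cod C g = Dom C h\<rbrakk>
          \<Longrightarrow> Comp C h (Comp C g f) = Comp C (Comp C h g) f"

definition connected_category :: "('o, 'a) cat \<Rightarrow> bool" where
  "connected_category C \<longleftrightarrow> category C \<and>
     (\<forall>x\<in>Obj C. \<forall>y\<in>Obj C. equivclp (\<lambda>u v. \<exists>f\<in>Arr C. Dom C f = u \<and> Cod C f = v) x y)"

text \<open>Only the values of a functor on the objects and arrows of its source are meaningful;
  equality of functors is therefore \<open>functor_eq\<close>, and the restriction of a functor to a
  subcategory \<open>U\<close> is the same pair of maps regarded as a functor on \<open>U\<close>.\<close>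

record ('o, 'a, 'p, 'b) funct =
  on_obj :: "'o \<Rightarrow> 'p"
  on_arr :: "'a \<Rightarrow> 'b"

locale is_functor = source: category C + target: category D
  for C :: "('o, 'a) cat" and D :: "('p, 'b) cat" +
  fixes F :: "('o, 'a, 'p, 'b) funct"
  assumes on_obj_in: "x \<in> Obj C \<Longrightarrow> on_obj F x \<in> Obj D"
    and on_arr_in: "f \<in> Arr C \<Longrightarrow> on_arr F f \<in> Arr D"
    and on_arr_Dom: "f \<in> Arr C \<Longrightarrow> Dom D (on_arr F f) = on_obj F (Dom C f)"
    and on_arr_Cod: "f \<in> Arr C \<Longrightarrow> Cod D (on_arr F f) = on_obj F (Cod C f)"
    and on_arr_Idn: "x \<in> Obj C \<Longrightarrow> on_arr F (Idn C x) = Idn D (on_obj F x)"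
    and on_arr_Comp: "\<lbrakk>f \<in> Arr C; g \<in> Arr C; Cod C f = Dom C g\<rbrakk>
          \<Longrightarrow> on_arr F (Comp C g f) = Comp D (on_arr F g) (on_arr F f)"

definition functor_eq ::
    "('o, 'a) cat \<Rightarrow> ('o, 'a, 'p, 'b) funct \<Rightarrow> ('o, 'a, 'p, 'b) funct \<Rightarrow> bool" where
  "functor_eq C F G \<longleftrightarrow>
     (\<forall>x\<in>Obj C. on_obj F x = on_obj G x) \<and> (\<forall>f\<in>Arr C. on_arr F f = on_arr G f)"

definition id_functor :: "('o, 'a, 'o, 'a) funct" where
  "id_functor = \<lparr>on_obj = id, on_arr = id\<rparr>"

definition comp_functor ::
    "('p, 'b, 'q, 'c) funct \<Rightarrow> ('o, 'a, 'p, 'b) funct \<Rightarrow> ('o, 'a, 'q, 'c) funct"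
    (infixl "\<circ>\<^sub>F" 55) where
  "G \<circ>\<^sub>F F = \<lparr>on_obj = on_obj G \<circ> on_obj F, on_arr = on_arr G \<circ> on_arr F\<rparr>"

locale subcategory = sub: category U + ambient: category C
  for U :: "('o, 'a) cat" and C :: "('o, 'a) cat" +
  assumes Obj_sub: "Obj U \<subseteq> Obj C"
    and Arr_sub: "Arr U \<subseteq> Arr C"
    and Dom_sub: "f \<in> Arr U \<Longrightarrow> Dom U f = Dom C f"
    and Cod_sub: "f \<in> Arr U \<Longrightarrow> Cod U f = Cod C f"
    and Idn_sub: "x \<in> Obj U \<Longrightarrow> Idn U x = Idn C x"
    and Comp_sub: "\<lbrakk>f \<in> Arr U; g \<in> Arr U; Cod U f = Dom U g\<rbrakk> \<Longrightarrow> Comp U g f = Comp C g f"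

definition prod_category :: "('o, 'a) cat \<Rightarrow> ('p, 'b) cat \<Rightarrow> ('o \<times> 'p, 'a \<times> 'b) cat"
    (infixr "\<times>\<^sub>C" 80) where
  "C \<times>\<^sub>C D = \<lparr>Obj = Obj C \<times> Obj D, Arr = Arr C \<times> Arr D,
     Dom = (\<lambda>(f, g). (Dom C f, Dom D g)), Cod = (\<lambda>(f, g). (Cod C f, Cod D g)),
     Idn = (\<lambda>(x, y). (Idn C x, Idn D y)),
     Comp = (\<lambda>(f', g') (f, g). (Comp C f' f, Comp D g' g))\<rparr>"

text \<open>The arrow \<open>r \<rightarrow> s\<close> of the interval category is encoded as the pair \<open>(r, s)\<close>;
  the case \<open>s = r - 1\<close> is written \<open>r = s + 1\<close> to avoid truncated subtraction.\<close>

definition interval_category :: "nat \<Rightarrow> (nat, nat \<times> nat) cat" where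
  "interval_category m = \<lparr>Obj = {..m},
     Arr = {(r, s). r \<le> m \<and> s \<le> m \<and> (r = s \<or> even r \<and> (r = s + 1 \<or> s = r + 1))},
     Dom = fst, Cod = snd, Idn = (\<lambda>r. (r, r)), Comp = (\<lambda>g f. (fst f, snd g))\<rparr>"

definition homotopy_at ::
    "('o \<times> nat, 'a \<times> (nat \<times> nat), 'p, 'b) funct \<Rightarrow> nat \<Rightarrow> ('o, 'a, 'p, 'b) funct" where
  "homotopy_at H r = \<lparr>on_obj = (\<lambda>x. on_obj H (x, r)), on_arr = (\<lambda>f. on_arr H (f, (r, r)))\<rparr>"

definition homotopic ::
    "('o, 'a) cat \<Rightarrow> ('p, 'b) cat \<Rightarrow> ('o, 'a, 'p, 'b) funct \<Rightarrow> ('o, 'a, 'p, 'b) funct \<Rightarrow> bool" where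
  "homotopic C D F G \<longleftrightarrow> is_functor C D F \<and> is_functor C D G \<and>
     (\<exists>m H. is_functor (C \<times>\<^sub>C interval_category m) D H \<and>
        functor_eq C (homotopy_at H 0) F \<and> functor_eq C (homotopy_at H m) G)"

definition geometric_cover :: "('o, 'a) cat \<Rightarrow> 'i set \<Rightarrow> ('i \<Rightarrow> ('o, 'a) cat) \<Rightarrow> bool" where
  "geometric_cover C \<Lambda> U \<longleftrightarrow> (\<forall>i\<in>\<Lambda>. subcategory (U i) C) \<and>
     (\<forall>fs. fs \<noteq> [] \<and> set fs \<subseteq> Arr C \<and> successively (\<lambda>f g. Cod C f = Dom C g) fs
        \<longrightarrow> (\<exists>i\<in>\<Lambda>. set fs \<subseteq> Arr (U i)))"

definition cD_le ::
    "('o, 'a) cat \<Rightarrow> ('p, 'b) cat \<Rightarrow> ('o, 'a, 'p, 'b) funct \<Rightarrow> ('o, 'a, 'p, 'b) funct \<Rightarrow> nat \<Rightarrow> bool" where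
  "cD_le C D F G n \<longleftrightarrow>
     (\<exists>U :: nat \<Rightarrow> ('o, 'a) cat. geometric_cover C {0..n} U \<and> (\<forall>j\<in>{0..n}. homotopic (U j) D F G))"

definition cD ::
    "('o, 'a) cat \<Rightarrow> ('p, 'b) cat \<Rightarrow> ('o, 'a, 'p, 'b) funct \<Rightarrow> ('o, 'a, 'p, 'b) funct \<Rightarrow> enat" where
  "cD C D F G = (if \<exists>n. cD_le C D F G n then enat (LEAST n. cD_le C D F G n) else \<infinity>)"

lemma category_prod:
  assumes "category C" "category D"
  shows "category (C \<times>\<^sub>C D)"
proof -
  interpret C: category C by fact
  interpret D: category D by fact
  show ?thesis
    by unfold_locales
      (auto simp: prod_category_def C.Dom_in C.Cod_in C.Idn_in C.Dom_Idn C.Cod_Idn C.Comp_in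
        C.Dom_Comp C.Cod_Comp C.Comp_Idn_right C.Comp_Idn_left C.Comp_assoc
        D.Dom_in D.Cod_in D.Idn_in D.Dom_Idn D.Cod_Idn D.Comp_in
        D.Dom_Comp D.Cod_Comp D.Comp_Idn_right D.Comp_Idn_left D.Comp_assoc)
qed

lemma category_interval: "category (interval_category m)"
  by unfold_locales (auto simp: interval_category_def)

lemma is_functor_id: "category C \<Longrightarrow> is_functor C C id_functor"
  by (simp add: is_functor_def is_functor_axioms_def id_functor_def)

lemma is_functor_comp:
  "is_functor C D F \<Longrightarrow> is_functor D E G \<Longrightarrow> is_functor C E (G \<circ>\<^sub>F F)"
  by (simp add: is_functor_def is_functor_axioms_def comp_functor_def)

lemma is_functor_restrict:
  assumes "is_functor C D F" "subcategory U C"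
  shows "is_functor U D F"
proof -
  interpret F: is_functor C D F by fact
  interpret U: subcategory U C by fact
  show ?thesis
    using U.Obj_sub U.Arr_sub
    by unfold_locales
      (auto simp: F.on_obj_in F.on_arr_in F.on_arr_Dom F.on_arr_Cod F.on_arr_Idn F.on_arr_Comp
        U.Dom_sub U.Cod_sub U.Idn_sub U.Comp_sub subset_iff)
qed

end

theory Submission
  imports Defs
begin

text \<open>Both parts rest on three monotonicity properties of \<open>cD_le\<close>. Postcomposition with a functor
  preserves it, because every homotopy over a member of the cover can be composed with that functor
  (\<open>cD_le_postcomp\<close>). Precomposition with a functor \<open>K\<close> preserves it, because the inverse images
  under \<open>K\<close> of the members of a geometric cover form a geometric cover, over which the given
  homotopies can be composed with \<open>K\<close> (\<open>cD_le_precomp\<close>). And \<open>cD_le\<close> depends only on the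
  homotopy classes of the two functors, because homotopies restrict to subcategories and can be
  reversed and concatenated (\<open>cD_le_homotopic\<close>).

  Composing with the given functor thus never increases the distance. Composing further with its
  one-sided homotopy inverse does not increase it either, and leads to functors homotopic to \<open>F\<close>
  and \<open>G\<close>, so the distance cannot have dropped. Each inequality holds for every fixed number of
  members of the cover, which also covers the value \<open>\<infinity>\<close>.

  The only point that needs care is that homotopy is an equivalence relation: the arrows of the
  interval category alternate in direction, so reversal and concatenation respect them only
  for intervals of even length. Any homotopy can be brought to even length by letting it stand still
  at its end.\<close>

section \<open>Operations on functors\<close>

lemma comp_functor_assoc: "(H \<circ>\<^sub>F G) \<circ>\<^sub>F F = H \<circ>\<^sub>F (G \<circ>\<^sub>F F)"
  by (simp add: comp_functor_def comp_assoc)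

lemma comp_functor_id_left: "id_functor \<circ>\<^sub>F F = F"
  by (simp add: comp_functor_def id_functor_def)

lemma comp_functor_id_right: "F \<circ>\<^sub>F id_functor = F"
  by (simp add: comp_functor_def id_functor_def)

definition prod_functor ::
    "('o, 'a, 'p, 'b) funct \<Rightarrow> ('o1, 'a1, 'p1, 'b1) funct
      \<Rightarrow> ('o \<times> 'o1, 'a \<times> 'a1, 'p \<times> 'p1, 'b \<times> 'b1) funct"
    (infixr "\<otimes>\<^sub>F" 80) where
  "F \<otimes>\<^sub>F G = \<lparr>on_obj = map_prod (on_obj F) (on_obj G), on_arr = map_prod (on_arr F) (on_arr G)\<rparr>"

lemma is_functor_prod:
  assumes "is_functor A B F" "is_functor A' B' F'"
  shows "is_functor (A \<times>\<^sub>C A') (B \<times>\<^sub>C B') (F \<otimes>\<^sub>F F')"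
proof -
  interpret F: is_functor A B F by fact
  interpret F': is_functor A' B' F' by fact
  interpret source: category "A \<times>\<^sub>C A'"
    by (intro category_prod F.source.category_axioms F'.source.category_axioms)
  interpret target: category "B \<times>\<^sub>C B'"
    by (intro category_prod F.target.category_axioms F'.target.category_axioms)
  show ?thesis
    by unfold_locales
      (auto simp: prod_category_def prod_functor_def
        F.on_obj_in F.on_arr_in F.on_arr_Dom F.on_arr_Cod F.on_arr_Idn F.on_arr_Comp
        F'.on_obj_in F'.on_arr_in F'.on_arr_Dom F'.on_arr_Cod F'.on_arr_Idn F'.on_arr_Comp)
qed

lemma is_functor_subcategory_inclusion: "subcategory U C \<Longrightarrow> is_functor U C id_functor"
  using is_functor_id is_functor_restrict subcategory.axioms(2) by blast

definition interval_map :: "(nat \<Rightarrow> nat) \<Rightarrow> (nat, nat \<times> nat, nat, nat \<times> nat) funct" where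
  "interval_map \<phi> = \<lparr>on_obj = \<phi>, on_arr = map_prod \<phi> \<phi>\<rparr>"

text \<open>Preservation of composites is automatic, since an arrow of an interval category is determined
  by its endpoints.\<close>

lemma is_functor_interval_map:
  assumes "\<And>r. r \<le> n \<Longrightarrow> \<phi> r \<le> m"
    and "\<And>r s. (r, s) \<in> Arr (interval_category n) \<Longrightarrow> (\<phi> r, \<phi> s) \<in> Arr (interval_category m)"
  shows "is_functor (interval_category n) (interval_category m) (interval_map \<phi>)"
proof -
  have "on_arr (interval_map \<phi>) f \<in> Arr (interval_category m)"
    if "f \<in> Arr (interval_category n)" for f
    using assms(2)[of "fst f" "snd f"] that by (simp add: interval_map_def map_prod_def split_def)
  then show ?thesis
    using assms(1) category_interval
    by (auto simp: is_functor_def is_functor_axioms_def)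
       (auto simp: interval_map_def interval_category_def)
qed

section \<open>Homotopy of functors\<close>

lemma homotopicI:
  assumes "is_functor C D F" "is_functor C D G" "is_functor (C \<times>\<^sub>C interval_category m) D H"
    and "functor_eq C (homotopy_at H 0) F" "functor_eq C (homotopy_at H m) G"
  shows "homotopic C D F G"
  using assms unfolding homotopic_def by blast

text \<open>Precomposition by \<open>K\<close> on the category and postcomposition by \<open>L\<close> compose a homotopy \<open>H\<close> to
  \<open>L \<circ>\<^sub>F H \<circ>\<^sub>F (K \<otimes>\<^sub>F id)\<close>.\<close>

lemma homotopic_postcomp:
  assumes "homotopic C D F G" "is_functor D E L"
  shows "homotopic C E (L \<circ>\<^sub>F F) (L \<circ>\<^sub>F G)"
proof -
  from assms(1) obtain m H where H: "is_functor C D F" "is_functor C D G"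
    "is_functor (C \<times>\<^sub>C interval_category m) D H"
    "functor_eq C (homotopy_at H 0) F" "functor_eq C (homotopy_at H m) G"
    unfolding homotopic_def by blast
  have "functor_eq C (homotopy_at (L \<circ>\<^sub>F H) 0) (L \<circ>\<^sub>F F)"
    "functor_eq C (homotopy_at (L \<circ>\<^sub>F H) m) (L \<circ>\<^sub>F G)"
    using H(4,5) by (auto simp: functor_eq_def homotopy_at_def comp_functor_def)
  then show ?thesis
    by (rule homotopicI[rotated 3]) (use H(1-3) assms(2) in \<open>auto intro: is_functor_comp\<close>)
qed

lemma homotopic_precomp:
  assumes "homotopic C D F G" "is_functor B C K"
  shows "homotopic B D (F \<circ>\<^sub>F K) (G \<circ>\<^sub>F K)"
proof -
  from assms(1) obtain m H where H: "is_functor C D F" "is_functor C D G"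
    "is_functor (C \<times>\<^sub>C interval_category m) D H"
    "functor_eq C (homotopy_at H 0) F" "functor_eq C (homotopy_at H m) G"
    unfolding homotopic_def by blast
  let ?H = "H \<circ>\<^sub>F (K \<otimes>\<^sub>F id_functor)"
  have "is_functor (B \<times>\<^sub>C interval_category m) D ?H"
    by (intro is_functor_comp[OF _ H(3)] is_functor_prod assms(2) is_functor_id category_interval)
  moreover have "functor_eq B (homotopy_at ?H 0) (F \<circ>\<^sub>F K)"
    "functor_eq B (homotopy_at ?H m) (G \<circ>\<^sub>F K)"
    using H(4,5) is_functor.on_obj_in[OF assms(2)] is_functor.on_arr_in[OF assms(2)]
    by (auto simp: functor_eq_def homotopy_at_def comp_functor_def prod_functor_def id_functor_def)
  ultimately show ?thesis
    using is_functor_comp[OF assms(2)] H(1,2) by (blast intro: homotopicI)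
qed

lemma homotopic_restrict:
  assumes "homotopic C D F G" "subcategory U C"
  shows "homotopic U D F G"
  using homotopic_precomp[OF assms(1) is_functor_subcategory_inclusion[OF assms(2)]]
  by (simp add: comp_functor_id_right)

text \<open>The truncation \<open>r \<mapsto> min r m\<close> retracts the interval of length \<open>2 * m\<close> onto that of length \<open>m\<close>
  and makes a homotopy stay at its end, so its length may be assumed even.\<close>

lemma homotopic_even_length:
  assumes "homotopic C D F G"
  obtains m H where "even m" "is_functor (C \<times>\<^sub>C interval_category m) D H"
    "functor_eq C (homotopy_at H 0) F" "functor_eq C (homotopy_at H m) G"
proof -
  from assms obtain m H where H: "is_functor C D F"
    "is_functor (C \<times>\<^sub>C interval_category m) D H"
    "functor_eq C (homotopy_at H 0) F" "functor_eq C (homotopy_at H m) G"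
    unfolding homotopic_def by blast
  let ?\<phi> = "\<lambda>r. min r m"
  let ?H = "H \<circ>\<^sub>F (id_functor \<otimes>\<^sub>F interval_map ?\<phi>)"
  have "is_functor (interval_category (2 * m)) (interval_category m) (interval_map ?\<phi>)"
    by (rule is_functor_interval_map) (auto simp: interval_category_def min_def)
  then have "is_functor (C \<times>\<^sub>C interval_category (2 * m)) D ?H"
    by (intro is_functor_comp[OF _ H(2)] is_functor_prod is_functor_id)
       (use H(1) in \<open>auto simp: is_functor_def\<close>)
  moreover have "functor_eq C (homotopy_at ?H 0) F" "functor_eq C (homotopy_at ?H (2 * m)) G"
    using H(3,4) by (auto simp: functor_eq_def homotopy_at_def comp_functor_def prod_functor_def
        id_functor_def interval_map_def)
  ultimately show ?thesis
    using that[of "2 * m"] by simp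
qed

lemma homotopic_sym:
  assumes "homotopic C D F G"
  shows "homotopic C D G F"
proof -
  obtain m H where "even m" and H: "is_functor (C \<times>\<^sub>C interval_category m) D H"
    "functor_eq C (homotopy_at H 0) F" "functor_eq C (homotopy_at H m) G"
    using homotopic_even_length[OF assms] .
  have F: "is_functor C D F" and G: "is_functor C D G"
    using assms by (auto simp: homotopic_def)
  let ?\<phi> = "\<lambda>r. m - r"
  let ?H = "H \<circ>\<^sub>F (id_functor \<otimes>\<^sub>F interval_map ?\<phi>)"
  \<comment> \<open>As \<open>m\<close> is even, \<open>r \<mapsto> m - r\<close> preserves parity and hence the direction of arrows.\<close>
  have "is_functor (interval_category m) (interval_category m) (interval_map ?\<phi>)"
    by (rule is_functor_interval_map) (use \<open>even m\<close> in \<open>auto simp: interval_category_def\<close>)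
  then have "is_functor (C \<times>\<^sub>C interval_category m) D ?H"
    by (intro is_functor_comp[OF _ H(1)] is_functor_prod is_functor_id)
       (use F in \<open>auto simp: is_functor_def\<close>)
  then show ?thesis
    by (rule homotopicI[rotated 2])
       (use F G H in \<open>auto simp: functor_eq_def homotopy_at_def comp_functor_def prod_functor_def
         id_functor_def interval_map_def\<close>)
qed

text \<open>Two homotopies that agree where they meet are glued along the even vertex \<open>m\<close>. An arrow of the
  long interval lies in one of the two parts, and at \<open>m\<close> itself both formulas give the common
  functor \<open>G\<close>. Since every non-identity arrow leads from an even to an odd vertex, one of any two
  composable arrows is an identity; so composable arrows in different parts can only occur if one
  of them is the identity of \<open>m\<close>, which belongs to both.\<close>

lemma homotopic_trans:
  assumes "homotopic C D F G" "homotopic C D G K"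
  shows "homotopic C D F K"
proof -
  obtain m H1 where "even m" and H1: "is_functor (C \<times>\<^sub>C interval_category m) D H1"
    "functor_eq C (homotopy_at H1 0) F" "functor_eq C (homotopy_at H1 m) G"
    using homotopic_even_length[OF assms(1)] .
  from assms obtain n H2 where FK: "is_functor C D F" "is_functor C D K"
    and H2: "is_functor (C \<times>\<^sub>C interval_category n) D H2"
    "functor_eq C (homotopy_at H2 0) G" "functor_eq C (homotopy_at H2 n) K"
    unfolding homotopic_def by blast
  interpret H1: is_functor "C \<times>\<^sub>C interval_category m" D H1 by fact
  interpret H2: is_functor "C \<times>\<^sub>C interval_category n" D H2 by fact
  interpret C: category C using FK(1) by (simp add: is_functor_def)
  let ?J = "interval_category (m + n)"
  define H where "H = \<lparr>
    on_obj = (\<lambda>(x, r). if r \<le> m then on_obj H1 (x, r) else on_obj H2 (x, r - m)),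
    on_arr = (\<lambda>(f, r, s). if r \<le> m \<and> s \<le> m then on_arr H1 (f, r, s)
                          else on_arr H2 (f, r - m, s - m))\<rparr>"
  have meet: "on_obj H1 (x, m) = on_obj H2 (x, 0)" if "x \<in> Obj C" for x
    using H1(3) H2(2) that by (simp add: functor_eq_def homotopy_at_def)
  have meet_arr: "on_arr H1 (f, m, m) = on_arr H2 (f, 0, 0)" if "f \<in> Arr C" for f
    using H1(3) H2(2) that by (simp add: functor_eq_def homotopy_at_def)
  have obj_left: "on_obj H (x, r) = on_obj H1 (x, r)" if "r \<le> m" for x r
    using that by (simp add: H_def)
  have obj_right: "on_obj H (x, r) = on_obj H2 (x, r - m)" if "x \<in> Obj C" "m \<le> r" for x r
    using that meet by (auto simp: H_def)
  have arr_left: "on_arr H (f, r, s) = on_arr H1 (f, r, s)" if "r \<le> m" "s \<le> m" for f r s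
    using that by (simp add: H_def)
  have arr_right: "on_arr H (f, r, s) = on_arr H2 (f, r - m, s - m)"
    if "f \<in> Arr C" "m \<le> r" "m \<le> s" for f r s
    using that meet_arr by (auto simp: H_def)
  have parts: "(r, s) \<in> Arr (interval_category m) \<or>
      m \<le> r \<and> m \<le> s \<and> (r - m, s - m) \<in> Arr (interval_category n)"
    if "(r, s) \<in> Arr ?J" for r s
    using that \<open>even m\<close> by (auto simp: interval_category_def)
  have composable_parts: "(r, s) \<in> Arr (interval_category m) \<and> (s, t) \<in> Arr (interval_category m) \<or>
      m \<le> r \<and> m \<le> s \<and> m \<le> t \<and> (r - m, s - m) \<in> Arr (interval_category n)
        \<and> (s - m, t - m) \<in> Arr (interval_category n)"
    if "(r, s) \<in> Arr ?J" "(s, t) \<in> Arr ?J" for r s t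
    using that \<open>even m\<close> by (auto simp: interval_category_def)
  have le: "r \<le> m \<and> s \<le> m" if "(r, s) \<in> Arr (interval_category m)" for r s m
    using that by (simp add: interval_category_def)
  note prod_simps = prod_category_def interval_category_def
  have "is_functor (C \<times>\<^sub>C ?J) D H"
  proof (intro is_functor.intro is_functor_axioms.intro category_prod category_interval
      C.category_axioms H1.target.category_axioms)
    fix z assume "z \<in> Obj (C \<times>\<^sub>C ?J)"
    then obtain x r where z: "z = (x, r)" "x \<in> Obj C" "r \<le> m + n"
      by (auto simp: prod_simps)
    show "on_obj H z \<in> Obj D"
      using z H1.on_obj_in[of "(x, r)"] H2.on_obj_in[of "(x, r - m)"]
      by (auto simp: H_def prod_simps)
    show "on_arr H (Idn (C \<times>\<^sub>C ?J) z) = Idn D (on_obj H z)"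
      using z H1.on_arr_Idn[of "(x, r)"] H2.on_arr_Idn[of "(x, r - m)"]
      by (auto simp: H_def prod_simps)
  next
    fix a assume "a \<in> Arr (C \<times>\<^sub>C ?J)"
    then obtain f r s where a: "a = (f, r, s)" "f \<in> Arr C" "(r, s) \<in> Arr ?J"
      by (auto simp: prod_category_def)
    have "on_arr H a \<in> Arr D \<and> Dom D (on_arr H a) = on_obj H (Dom C f, r)
        \<and> Cod D (on_arr H a) = on_obj H (Cod C f, s)"
      using parts[OF a(3)]
    proof (elim disjE conjE)
      assume rs: "(r, s) \<in> Arr (interval_category m)"
      then have "(f, r, s) \<in> Arr (C \<times>\<^sub>C interval_category m)"
        using a by (simp add: prod_category_def)
      from H1.on_arr_in[OF this] H1.on_arr_Dom[OF this] H1.on_arr_Cod[OF this] show ?thesis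
        using a le[OF rs] by (simp add: arr_left obj_left) (simp add: prod_simps)
    next
      assume rs: "m \<le> r" "m \<le> s" "(r - m, s - m) \<in> Arr (interval_category n)"
      then have "(f, r - m, s - m) \<in> Arr (C \<times>\<^sub>C interval_category n)"
        using a by (simp add: prod_category_def)
      from H2.on_arr_in[OF this] H2.on_arr_Dom[OF this] H2.on_arr_Cod[OF this] show ?thesis
        using a rs by (simp add: arr_right obj_right C.Dom_in C.Cod_in) (simp add: prod_simps)
    qed
    then show "on_arr H a \<in> Arr D" "Dom D (on_arr H a) = on_obj H (Dom (C \<times>\<^sub>C ?J) a)"
      "Cod D (on_arr H a) = on_obj H (Cod (C \<times>\<^sub>C ?J) a)"
      using a by (simp_all add: prod_simps)
  next
    fix a b assume "a \<in> Arr (C \<times>\<^sub>C ?J)" "b \<in> Arr (C \<times>\<^sub>C ?J)"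
      "Cod (C \<times>\<^sub>C ?J) a = Dom (C \<times>\<^sub>C ?J) b"
    then obtain f g r s t where ab: "a = (f, r, s)" "b = (g, s, t)" "f \<in> Arr C" "g \<in> Arr C"
      "Cod C f = Dom C g" "(r, s) \<in> Arr ?J" "(s, t) \<in> Arr ?J"
      by (auto simp: prod_simps)
    have "on_arr H (Comp C g f, r, t) = Comp D (on_arr H b) (on_arr H a)"
      using composable_parts[OF ab(6,7)]
    proof (elim disjE conjE)
      assume rst: "(r, s) \<in> Arr (interval_category m)" "(s, t) \<in> Arr (interval_category m)"
      have "on_arr H1 (Comp C g f, r, t) = Comp D (on_arr H1 b) (on_arr H1 a)"
        using H1.on_arr_Comp[of a b] ab rst by (simp add: prod_simps)
      then show ?thesis
        using ab le[OF rst(1)] le[OF rst(2)] by (simp add: arr_left)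
    next
      assume rst: "m \<le> r" "m \<le> s" "m \<le> t" "(r - m, s - m) \<in> Arr (interval_category n)"
        "(s - m, t - m) \<in> Arr (interval_category n)"
      have "on_arr H2 (Comp C g f, r - m, t - m)
          = Comp D (on_arr H2 (g, s - m, t - m)) (on_arr H2 (f, r - m, s - m))"
        using H2.on_arr_Comp[of "(f, r - m, s - m)" "(g, s - m, t - m)"] ab rst
        by (simp add: prod_simps)
      then show ?thesis
        using ab rst by (simp add: arr_right C.Comp_in)
    qed
    then show "on_arr H (Comp (C \<times>\<^sub>C ?J) b a) = Comp D (on_arr H b) (on_arr H a)"
      using ab by (simp add: prod_simps)
  qed
  then show ?thesis
  proof (rule homotopicI[OF FK])
    show "functor_eq C (homotopy_at H 0) F"
      using H1(2) by (simp add: functor_eq_def homotopy_at_def obj_left arr_left)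
    show "functor_eq C (homotopy_at H (m + n)) K"
      using H2(3) by (simp add: functor_eq_def homotopy_at_def obj_right arr_right)
  qed
qed

section \<open>Inverse images of geometric covers\<close>

definition preimage_category ::
    "('o, 'a) cat \<Rightarrow> ('o, 'a, 'p, 'b) funct \<Rightarrow> ('p, 'b) cat \<Rightarrow> ('o, 'a) cat" where
  "preimage_category B K U =
     B\<lparr>Obj := {x \<in> Obj B. on_obj K x \<in> Obj U}, Arr := {f \<in> Arr B. on_arr K f \<in> Arr U}\<rparr>"

lemma
  assumes "is_functor B C K" "subcategory U C"
  shows subcategory_preimage: "subcategory (preimage_category B K U) B"
    and is_functor_preimage: "is_functor (preimage_category B K U) U K"
proof -
  interpret K: is_functor B C K by fact
  interpret U: subcategory U C by fact
  have Dom: "on_obj K (Dom B f) = Dom U (on_arr K f)"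
    and Cod: "on_obj K (Cod B f) = Cod U (on_arr K f)" if "f \<in> Arr B" "on_arr K f \<in> Arr U" for f
    using that by (simp_all add: K.on_arr_Dom K.on_arr_Cod U.Dom_sub U.Cod_sub)
  have Idn: "on_arr K (Idn B x) = Idn U (on_obj K x)" if "x \<in> Obj B" "on_obj K x \<in> Obj U" for x
    using that by (simp add: K.on_arr_Idn U.Idn_sub)
  have Comp: "on_arr K (Comp B g f) = Comp U (on_arr K g) (on_arr K f)"
    and composable: "Cod U (on_arr K f) = Dom U (on_arr K g)"
    if "f \<in> Arr B" "on_arr K f \<in> Arr U" "g \<in> Arr B" "on_arr K g \<in> Arr U" "Cod B f = Dom B g"
    for f g
    using that Dom[of g] Cod[of f] by (simp_all add: K.on_arr_Comp U.Comp_sub)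
  interpret P: category "preimage_category B K U"
    by unfold_locales
      (simp_all add: preimage_category_def K.source.Dom_in K.source.Cod_in K.source.Idn_in
        K.source.Dom_Idn K.source.Cod_Idn K.source.Comp_in K.source.Dom_Comp K.source.Cod_Comp
        K.source.Comp_Idn_right K.source.Comp_Idn_left K.source.Comp_assoc Dom Cod Idn Comp
        composable U.sub.Dom_in U.sub.Cod_in U.sub.Idn_in U.sub.Comp_in)
  show "subcategory (preimage_category B K U) B"
    by unfold_locales (auto simp: preimage_category_def)
  show "is_functor (preimage_category B K U) U K"
    by unfold_locales (simp_all add: preimage_category_def Dom Cod Idn Comp)
qed

text \<open>A functor sends composable sequences to composable sequences, and a member of the cover that
  contains all arrows of the image sequence has all arrows of the original one in its inverse
  image.\<close>

lemma geometric_cover_preimage: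
  assumes "is_functor B C K" "geometric_cover C \<Lambda> U"
  shows "geometric_cover B \<Lambda> (\<lambda>i. preimage_category B K (U i))"
proof -
  interpret K: is_functor B C K by fact
  have "\<exists>i\<in>\<Lambda>. set fs \<subseteq> Arr (preimage_category B K (U i))"
    if fs: "fs \<noteq> []" "set fs \<subseteq> Arr B" "successively (\<lambda>f g. Cod B f = Dom B g) fs" for fs
  proof -
    let ?gs = "map (on_arr K) fs"
    have "successively (\<lambda>f g. Cod C (on_arr K f) = Dom C (on_arr K g)) fs"
      by (rule successively_mono[OF fs(3)])
         (use fs(2) in \<open>auto simp: subset_iff K.on_arr_Dom K.on_arr_Cod\<close>)
    then have "successively (\<lambda>f g. Cod C f = Dom C g) ?gs"
      by (simp add: successively_map)
    moreover have "?gs \<noteq> []" "set ?gs \<subseteq> Arr C"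
      using fs K.on_arr_in by auto
    ultimately obtain i where "i \<in> \<Lambda>" "set ?gs \<subseteq> Arr (U i)"
      using assms(2) unfolding geometric_cover_def by blast
    then show ?thesis
      using fs(2) by (auto simp: preimage_category_def)
  qed
  moreover have "subcategory (preimage_category B K (U i)) B" if "i \<in> \<Lambda>" for i
    using assms that by (intro subcategory_preimage) (auto simp: geometric_cover_def)
  ultimately show ?thesis
    unfolding geometric_cover_def by simp
qed

section \<open>Categorical homotopic distance\<close>

lemma cD_eqI: "(\<And>n. cD_le C D F G n \<longleftrightarrow> cD_le C' D' F' G' n) \<Longrightarrow> cD C D F G = cD C' D' F' G'"
  unfolding cD_def by presburger

lemma cD_le_postcomp:
  assumes "cD_le C D F G n" "is_functor D E L"
  shows "cD_le C E (L \<circ>\<^sub>F F) (L \<circ>\<^sub>F G) n"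
  using assms homotopic_postcomp unfolding cD_le_def by blast

lemma cD_le_precomp:
  assumes "cD_le C D F G n" "is_functor B C K"
  shows "cD_le B D (F \<circ>\<^sub>F K) (G \<circ>\<^sub>F K) n"
proof -
  obtain U where U: "geometric_cover C {0..n} U" "\<forall>j\<in>{0..n}. homotopic (U j) D F G"
    using assms(1) unfolding cD_le_def by blast
  have "homotopic (preimage_category B K (U j)) D (F \<circ>\<^sub>F K) (G \<circ>\<^sub>F K)" if "j \<in> {0..n}" for j
    using that U assms(2)
    by (auto intro!: homotopic_precomp is_functor_preimage simp: geometric_cover_def)
  then show ?thesis
    using geometric_cover_preimage[OF assms(2) U(1)] unfolding cD_le_def by blast
qed

lemma cD_le_homotopic:
  assumes "cD_le C D F G n" "homotopic C D F F'" "homotopic C D G G'"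
  shows "cD_le C D F' G' n"
proof -
  obtain U where U: "geometric_cover C {0..n} U" "\<forall>j\<in>{0..n}. homotopic (U j) D F G"
    using assms(1) unfolding cD_le_def by blast
  have "homotopic (U j) D F' G'" if "j \<in> {0..n}" for j
  proof -
    have "subcategory (U j) C"
      using U(1) that by (simp add: geometric_cover_def)
    then have "homotopic (U j) D F' F" "homotopic (U j) D G G'"
      using assms(2,3) homotopic_restrict homotopic_sym by blast+
    then show ?thesis
      using U(2) that homotopic_trans by blast
  qed
  then show ?thesis
    using U(1) unfolding cD_le_def by blast
qed

lemma cD_postcomp_left_homotopy_inverse:
  assumes "is_functor C D F" "is_functor C D G" "is_functor D D' \<alpha>" "is_functor D' D \<beta>"
    and "homotopic D D (\<beta> \<circ>\<^sub>F \<alpha>) id_functor"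
  shows "cD C D' (\<alpha> \<circ>\<^sub>F F) (\<alpha> \<circ>\<^sub>F G) = cD C D F G"
proof (intro cD_eqI iffI)
  fix n
  have contract: "homotopic C D (\<beta> \<circ>\<^sub>F (\<alpha> \<circ>\<^sub>F L)) L" if "is_functor C D L" for L
    using homotopic_precomp[OF assms(5) that]
    by (simp add: comp_functor_id_left comp_functor_assoc)
  assume "cD_le C D' (\<alpha> \<circ>\<^sub>F F) (\<alpha> \<circ>\<^sub>F G) n"
  from cD_le_postcomp[OF this assms(4)] show "cD_le C D F G n"
    using contract[OF assms(1)] contract[OF assms(2)] by (rule cD_le_homotopic)
qed (rule cD_le_postcomp[OF _ assms(3)])

lemma cD_precomp_right_homotopy_inverse:
  assumes "is_functor C D F" "is_functor C D G" "is_functor C' C \<beta>" "is_functor C C' \<alpha>"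
    and "homotopic C C (\<beta> \<circ>\<^sub>F \<alpha>) id_functor"
  shows "cD C' D (F \<circ>\<^sub>F \<beta>) (G \<circ>\<^sub>F \<beta>) = cD C D F G"
proof (intro cD_eqI iffI)
  fix n
  have contract: "homotopic C D ((L \<circ>\<^sub>F \<beta>) \<circ>\<^sub>F \<alpha>) L" if "is_functor C D L" for L
    using homotopic_postcomp[OF assms(5) that]
    by (simp add: comp_functor_id_right comp_functor_assoc)
  assume "cD_le C' D (F \<circ>\<^sub>F \<beta>) (G \<circ>\<^sub>F \<beta>) n"
  from cD_le_precomp[OF this assms(4)] show "cD_le C D F G n"
    using contract[OF assms(1)] contract[OF assms(2)] by (rule cD_le_homotopic)
qed (rule cD_le_precomp[OF _ assms(3)])

theorem corollary4p11:
  fixes C :: "('o, 'a) cat" and D :: "('p, 'b) cat"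
    and C' :: "('o1, 'a1) cat" and D' :: "('p1, 'b1) cat"
    and F G :: "('o, 'a, 'p, 'b) funct"
  assumes "connected_category C" and "connected_category D"
    and "connected_category C'" and "connected_category D'"
    and "is_functor C D F" and "is_functor C D G"
  shows "(\<forall>\<alpha>. is_functor D D' \<alpha> \<and>
            (\<exists>\<beta>. is_functor D' D \<beta> \<and> homotopic D D (\<beta> \<circ>\<^sub>F \<alpha>) id_functor)
          \<longrightarrow> cD C D' (\<alpha> \<circ>\<^sub>F F) (\<alpha> \<circ>\<^sub>F G) = cD C D F G) \<and>
         (\<forall>\<beta>. is_functor C' C \<beta> \<and>
            (\<exists>\<alpha>. is_functor C C' \<alpha> \<and> homotopic C C (\<beta> \<circ>\<^sub>F \<alpha>) id_functor)
          \<longrightarrow> cD C' D (F \<circ>\<^sub>F \<beta>) (G \<circ>\<^sub>F \<beta>) = cD C D F G)"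
  using cD_postcomp_left_homotopy_inverse[OF assms(5,6)]
    cD_precomp_right_homotopy_inverse[OF assms(5,6)]
  by blast

end
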